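(* Let $X$ be a time-homogeneous Markov process on a Polish space $\mathbb{X}$ with transition kernel $Q$, $f:\mathbb{X}\to[0,\infty)$ a bounded Borel payoff function, and $\delta:\{0,1,2,\dots\}\to[0,1]$ a strictly decreasing discount function with $\delta(0)=1$ and $\lim_{k\to\infty}\delta(k)=0$. Suppose that $\delta(i)\delta(j)\le\delta(i+j)$ for all $i,j=0,1,2,\dots$, that $f$ is lower semicontinuous, and that for any bounded Borel measurable $g:\mathbb{X}\to\mathbb{R}$ and any sequence $(x_n)_{n\in\mathbb{N}}$ in $\mathbb{X}$ with $x_n\to x\in\mathbb{X}$, $$\liminf_{n\to\infty}\int_{\mathbb{X}} g(y)\,Q(x_n,dy)\ \ge\ \int_{\mathbb{X}} g(y)\,Q(x,dy).$$ Then $S^*:=\bigcap_{S\in\mathcal{E}}S$, the intersection of all equilibria, is the optimal equilibrium.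
   Context: Setting. $\mathbb{X}$ is a Polish space with Borel $\sigma$-algebra $\mathcal{B}(\mathbb{X})$; $X=(X_t)_{t=0,1,2,\dots}$ is a time-homogeneous $\mathbb{X}$-valued Markov process with transition kernel $Q$, i.e. $\mathbb{P}(X_{t+1}\in A\mid X_t=x)=\int_A Q(x,dy)$ for all $t\ge 0$, $x\in\mathbb{X}$, $A\in\mathcal{B}(\mathbb{X})$. Write $X^x$ for the process started at $X_0=x$ and $\mathbb{E}^x$ for expectation conditional on $X_0=x$. Stopping times are with respect to the filtration generated by $X$ and may take the value $\infty$. For $x\in\mathbb{X}$ and a stopping time $\tau$, $J(x,\tau):=\mathbb{E}^x[\delta(\tau)f(X_\tau)]$, where $\delta(\tau)f(X_\tau):=0$ on $\{\tau=\infty\}$. For $S\in\mathcal{B}(\mathbb{X})$, $\rho(x,S):=\inf\{t\ge 1: X^x_t\in S\}$ (with $\inf\emptyset=\infty$), and $$\Theta(S):=\{x\in\mathbb{X}: f(x)\ge J(x,\rho(x,S))\}\in\mathcal{B}(\mathbb{X}).$$ A set $S\in\mathcal{B}(\mathbb{X})$ is called an equilibrium if $\Theta(S)=S$; $\mathcal{E}$ denotes the set of all equilibria. For $S\in\mathcal{E}$, the value function is $V(x,S):=f(x)\vee J(x,\rho(x,S))$, $x\in\mathbb{X}$. An equilibrium $S^*\in\mathcal{E}$ is called an optimal equilibrium if for every $S\in\mathcal{E}$, $V(x,S^* )\ge V(x,S)$ for all $x\in\mathbb{X}$. *)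

theory Defs
  imports "HOL-Probability.Probability"
begin

definition natural_filtration ::
  "'w measure \<Rightarrow> (nat \<Rightarrow> 'w \<Rightarrow> 'x::topological_space) \<Rightarrow> nat \<Rightarrow> 'w measure" where
  "natural_filtration M X t =
     sigma (space M) {X s -` A \<inter> space M | s A. s \<le> t \<and> A \<in> sets borel}"

definition transition_kernel :: "('x::topological_space \<Rightarrow> 'x measure) \<Rightarrow> bool" where
  "transition_kernel Q \<longleftrightarrow> Q \<in> borel \<rightarrow>\<^sub>M prob_algebra borel"

text \<open>The Markov property is taken with respect to the whole past of the process;
  time-homogeneity is expressed by using the same kernel at every time.\<close>

definition markov_process ::
  "'w measure \<Rightarrow> (nat \<Rightarrow> 'w \<Rightarrow> 'x::topological_space) \<Rightarrow> ('x \<Rightarrow> 'x measure) \<Rightarrow> bool" where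
  "markov_process M X Q \<longleftrightarrow>
     prob_space M \<and>
     (\<forall>t. X t \<in> borel_measurable M) \<and>
     (\<forall>t. \<forall>A \<in> sets borel. AE \<omega> in M.
        real_cond_exp M (natural_filtration M X t) (\<lambda>\<omega>. indicator A (X (Suc t) \<omega>)) \<omega>
          = measure (Q (X t \<omega>)) A)"

text \<open>For each starting point \<open>x\<close>, the process started at \<open>x\<close> is \<open>X x\<close>, living on the
  probability space \<open>P x\<close>; expectation conditional on starting at \<open>x\<close> is the integral with
  respect to \<open>P x\<close>. Taking \<open>X\<close> independent of \<open>x\<close> gives the usual picture of one process
  under a family of laws.\<close>

definition markov_family ::
  "('x::topological_space \<Rightarrow> 'w measure) \<Rightarrow> ('x \<Rightarrow> nat \<Rightarrow> 'w \<Rightarrow> 'x) \<Rightarrow> ('x \<Rightarrow> 'x measure) \<Rightarrow> bool"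
where
  "markov_family P X Q \<longleftrightarrow>
     (\<forall>x. markov_process (P x) (X x) Q \<and> (AE \<omega> in P x. X x 0 \<omega> = x))"

definition lower_semicontinuous :: "('x::topological_space \<Rightarrow> real) \<Rightarrow> bool" where
  "lower_semicontinuous f \<longleftrightarrow> (\<forall>x. \<forall>c < f x. \<forall>\<^sub>F y in nhds x. c < f y)"

definition discounted_payoff ::
  "(nat \<Rightarrow> real) \<Rightarrow> ('x \<Rightarrow> real) \<Rightarrow> (nat \<Rightarrow> 'w \<Rightarrow> 'x) \<Rightarrow> ('w \<Rightarrow> enat) \<Rightarrow> 'w \<Rightarrow> real" where
  "discounted_payoff \<delta> f X \<tau> \<omega> =
     (case \<tau> \<omega> of enat t \<Rightarrow> \<delta> t * f (X t \<omega>) | \<infinity> \<Rightarrow> 0)"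

definition J ::
  "('x \<Rightarrow> 'w measure) \<Rightarrow> ('x \<Rightarrow> nat \<Rightarrow> 'w \<Rightarrow> 'x) \<Rightarrow> (nat \<Rightarrow> real) \<Rightarrow> ('x \<Rightarrow> real) \<Rightarrow>
   'x \<Rightarrow> ('w \<Rightarrow> enat) \<Rightarrow> real" where
  "J P X \<delta> f x \<tau> = (\<integral>\<omega>. discounted_payoff \<delta> f (X x) \<tau> \<omega> \<partial>P x)"

text \<open>In \<open>enat\<close> the infimum of the empty set is \<open>\<infinity>\<close>.\<close>

definition \<rho> :: "('x \<Rightarrow> nat \<Rightarrow> 'w \<Rightarrow> 'x) \<Rightarrow> 'x \<Rightarrow> 'x set \<Rightarrow> 'w \<Rightarrow> enat" where
  "\<rho> X x S \<omega> = Inf {enat t | t. t \<ge> 1 \<and> X x t \<omega> \<in> S}"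

definition \<Theta> ::
  "('x \<Rightarrow> 'w measure) \<Rightarrow> ('x \<Rightarrow> nat \<Rightarrow> 'w \<Rightarrow> 'x) \<Rightarrow> (nat \<Rightarrow> real) \<Rightarrow> ('x \<Rightarrow> real) \<Rightarrow>
   'x set \<Rightarrow> 'x set" where
  "\<Theta> P X \<delta> f S = {x. f x \<ge> J P X \<delta> f x (\<rho> X x S)}"

definition equilibria ::
  "('x::topological_space \<Rightarrow> 'w measure) \<Rightarrow> ('x \<Rightarrow> nat \<Rightarrow> 'w \<Rightarrow> 'x) \<Rightarrow> (nat \<Rightarrow> real) \<Rightarrow>
   ('x \<Rightarrow> real) \<Rightarrow> 'x set set" where
  "equilibria P X \<delta> f = {S \<in> sets borel. \<Theta> P X \<delta> f S = S}"

definition V ::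
  "('x \<Rightarrow> 'w measure) \<Rightarrow> ('x \<Rightarrow> nat \<Rightarrow> 'w \<Rightarrow> 'x) \<Rightarrow> (nat \<Rightarrow> real) \<Rightarrow> ('x \<Rightarrow> real) \<Rightarrow>
   'x \<Rightarrow> 'x set \<Rightarrow> real" where
  "V P X \<delta> f x S = max (f x) (J P X \<delta> f x (\<rho> X x S))"

definition optimal_equilibrium ::
  "('x::topological_space \<Rightarrow> 'w measure) \<Rightarrow> ('x \<Rightarrow> nat \<Rightarrow> 'w \<Rightarrow> 'x) \<Rightarrow> (nat \<Rightarrow> real) \<Rightarrow>
   ('x \<Rightarrow> real) \<Rightarrow> 'x set \<Rightarrow> bool" where
  "optimal_equilibrium P X \<delta> f S' \<longleftrightarrow>
     S' \<in> equilibria P X \<delta> f \<and>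
     (\<forall>S \<in> equilibria P X \<delta> f. \<forall>x. V P X \<delta> f x S' \<ge> V P X \<delta> f x S)"

end

theory Submission
  imports Defs
begin

text \<open>
  Call a Borel set \<open>S\<close> a pre-equilibrium if \<open>\<Theta>(S) \<subseteq> S\<close>. The inequality \<open>\<delta>(i) \<delta>(j) \<le> \<delta>(i + j)\<close>
  makes waiting for a smaller set \<open>R\<close> at least as good as stopping at \<open>S\<close> and, outside \<open>R\<close>,
  restarting the wait for \<open>R\<close>. If every point of \<open>S - R\<close> prefers continuing to some member of a
  family of sets containing \<open>R\<close>, then the largest advantage \<open>c\<close> of a member of the family over \<open>R\<close>
  satisfies \<open>c \<le> \<delta>(1) c\<close>, so there is none. Applied to the single set \<open>S\<close> and \<open>R = \<Theta>(S)\<close>, this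
  shows that \<open>\<Theta>\<close> preserves pre-equilibria; applied to all pre-equilibria at once, it shows that
  their intersection \<open>R\<close> is a pre-equilibrium with the largest values. By minimality
  \<open>\<Theta>(R) = R\<close>, so \<open>R\<close> is an equilibrium and hence the intersection of all equilibria. The Feller
  condition makes the continuation values lower semicontinuous, so by Lindelof countably many
  pre-equilibria suffice to cut out \<open>R\<close>, which is therefore Borel.
\<close>

subsection \<open>Hitting operators of a transition kernel\<close>

lemma suminf_swap_ennreal:
  fixes c :: "nat \<Rightarrow> nat \<Rightarrow> ennreal"
  shows "(\<Sum>n. \<Sum>t. c n t) = (\<Sum>t. \<Sum>n. c n t)"
  using nn_integral_suminf[of "\<lambda>n t. c n t" "count_space UNIV"]
  by (simp add: nn_integral_count_space_nat)

text \<open>Reindexing by \<open>n = t + s + 1\<close>: a first stage ending at time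
  \<open>t + 1\<close>, followed by a second one of \<open>s + 1\<close> steps, ends at time
  \<open>n + 1\<close>.\<close>

lemma suminf_convolution_ennreal:
  fixes c :: "nat \<Rightarrow> nat \<Rightarrow> ennreal"
  shows "(\<Sum>n. \<Sum>t<n. c t (n - Suc t)) = (\<Sum>t. \<Sum>s. c t s)"
proof -
  have "(\<Sum>t<n. c t (n - Suc t)) = (\<Sum>t. if t < n then c t (n - Suc t) else 0)" for n
    by (subst suminf_finite[of "{..<n}"]) auto
  then have "(\<Sum>n. \<Sum>t<n. c t (n - Suc t))
      = (\<Sum>t. \<Sum>n. if t < n then c t (n - Suc t) else 0)"
    by (simp only: suminf_swap_ennreal[of "\<lambda>n t. if t < n then c t (n - Suc t) else 0"])
  moreover have "(\<Sum>n. if t < n then c t (n - Suc t) else 0) = (\<Sum>s. c t s)" for t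
    by (subst suminf_offset[where i = "Suc t"]) simp_all
  ultimately show ?thesis by simp
qed

text \<open>For the process started at \<open>x\<close>, \<open>hit Q S g t x\<close> is the expectation of \<open>g(X\<^bsub>t+1\<^esub>)\<close> on the event
  that \<open>S\<close> is not visited at the times \<open>1, \<dots>, t\<close>.\<close>

primrec hit ::
  "('x \<Rightarrow> 'x measure) \<Rightarrow> 'x set \<Rightarrow> ('x \<Rightarrow> ennreal) \<Rightarrow> nat \<Rightarrow> 'x \<Rightarrow> ennreal"
where
  "hit Q S g 0 x = (\<integral>\<^sup>+y. g y \<partial>Q x)"
| "hit Q S g (Suc t) x = (\<integral>\<^sup>+y. indicator (-S) y * hit Q S g t y \<partial>Q x)"

locale transition =
  fixes Q :: "'x::topological_space \<Rightarrow> 'x measure"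
  assumes Q: "Q \<in> borel \<rightarrow>\<^sub>M prob_algebra borel"
begin

lemma sets_Q [simp, measurable_cong]: "sets (Q x) = sets borel"
  using measurable_space[OF Q, of x] by (simp add: space_prob_algebra)

lemma space_Q [simp]: "space (Q x) = UNIV"
  using sets_eq_imp_space_eq[OF sets_Q, of x] by simp

lemma emeasure_Q_UNIV [simp]: "emeasure (Q x) UNIV = 1"
proof -
  have "prob_space (Q x)"
    using measurable_space[OF Q, of x] by (simp add: space_prob_algebra)
  from prob_space.emeasure_space_1[OF this] show ?thesis by simp
qed

lemma borel_measurable_Q [measurable]:
  fixes g :: "'x \<Rightarrow> ennreal"
  assumes "g \<in> borel_measurable borel"
  shows "(\<lambda>x. \<integral>\<^sup>+y. g y \<partial>Q x) \<in> borel_measurable borel"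
  using nn_integral_measurable_subprob_algebra[OF assms] measurable_prob_algebraD[OF Q]
  by (rule measurable_compose[rotated])

lemma hit_measurable [measurable]:
  assumes [measurable]: "S \<in> sets borel" "g \<in> borel_measurable borel"
  shows "hit Q S g t \<in> borel_measurable borel"
proof (induction t)
  case (Suc t)
  note Suc [measurable]
  show ?case by simp
qed simp

lemma hit_mono:
  assumes "\<And>y. g y \<le> h y"
  shows "hit Q S g t x \<le> hit Q S h t x"
proof (induction t arbitrary: x)
  case (Suc t)
  then show ?case by (auto intro!: nn_integral_mono mult_left_mono)
qed (simp add: nn_integral_mono assms)

lemma hit_add:
  assumes [measurable]: "S \<in> sets borel" "g \<in> borel_measurable borel" "h \<in> borel_measurable borel"
  shows "hit Q S (\<lambda>y. g y + h y) t x = hit Q S g t x + hit Q S h t x"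
  by (induction t arbitrary: x) (simp_all add: distrib_left nn_integral_add)

lemma hit_cmult:
  assumes [measurable]: "S \<in> sets borel" "g \<in> borel_measurable borel"
  shows "hit Q S (\<lambda>y. c * g y) t x = c * hit Q S g t x"
  by (induction t arbitrary: x) (simp_all add: nn_integral_cmult mult.left_commute[of _ c])

lemma hit_suminf:
  fixes g :: "nat \<Rightarrow> 'x \<Rightarrow> ennreal"
  assumes [measurable]: "S \<in> sets borel" "\<And>s. g s \<in> borel_measurable borel"
  shows "hit Q S (\<lambda>y. \<Sum>s. g s y) t x = (\<Sum>s. hit Q S (g s) t x)"
proof (induction t arbitrary: x)
  case 0
  show ?case by (simp add: nn_integral_suminf)
next
  case (Suc t)
  show ?case
    by (simp add: Suc flip: ennreal_suminf_cmult nn_integral_suminf)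
qed

lemma nn_integral_indicator_sum:
  fixes u :: "nat \<Rightarrow> 'x \<Rightarrow> ennreal"
  assumes [measurable]: "A \<in> sets borel" "\<And>t. u t \<in> borel_measurable borel"
  shows "(\<integral>\<^sup>+y. indicator A y * (\<Sum>t<n. u t y) \<partial>Q x) = (\<Sum>t<n. \<integral>\<^sup>+y. indicator A y * u t y \<partial>Q x)"
  unfolding sum_distrib_left by (rule nn_integral_sum) simp

text \<open>Splitting the first hit of \<open>R\<close> at time \<open>n + 1\<close> according to the first visit to \<open>S\<close>.\<close>

lemma hit_subset:
  assumes [measurable]: "R \<in> sets borel" "S \<in> sets borel" "g \<in> borel_measurable borel"
    and "R \<subseteq> S"
  shows "hit Q R g n x = hit Q S g n x
    + (\<Sum>t<n. hit Q S (\<lambda>y. indicator (S - R) y * hit Q R g (n - Suc t) y) t x)"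
proof (induction n arbitrary: x)
  case (Suc n)
  let ?h = "\<lambda>s y. indicator (S - R) y * hit Q R g s y"
  have split: "indicator (-R) y = (indicator (S - R) y + indicator (-S) y :: ennreal)" for y
    using \<open>R \<subseteq> S\<close> by (auto simp: indicator_def)
  \<comment> \<open>Condition on the first step. If it lands in \<open>S - R\<close>, then
    \<open>S\<close> is visited at once, which is the term \<open>t = 0\<close>; if it lands outside
    \<open>S\<close>, the induction hypothesis applies and shifts the index by one.\<close>
  have "hit Q R g (Suc n) x
    = hit Q S (?h n) 0 x + (\<integral>\<^sup>+y. indicator (-S) y * hit Q R g n y \<partial>Q x)"
    by (simp add: split distrib_right nn_integral_add)
  also have "(\<integral>\<^sup>+y. indicator (-S) y * hit Q R g n y \<partial>Q x)
    = hit Q S g (Suc n) x + (\<Sum>t<n. hit Q S (?h (n - Suc t)) (Suc t) x)"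
    by (simp add: Suc distrib_left nn_integral_add nn_integral_indicator_sum)
  finally show ?case
    by (simp add: sum.lessThan_Suc_shift ac_simps del: hit.simps sum.lessThan_Suc)
qed simp

text \<open>The summands are \<open>c\<close> times the probabilities of the disjoint events that
  \<open>S\<close> is first visited at time \<open>t + 1\<close>. Partial sums are bounded by
  conditioning on the first step.\<close>

lemma hit_total_le:
  assumes [measurable]: "S \<in> sets borel"
  shows "(\<Sum>t. hit Q S (\<lambda>y. indicator S y * c) t x) \<le> c"
proof -
  have partial: "(\<Sum>t<n. hit Q S (\<lambda>y. indicator S y * c) t x) \<le> c" for n
  proof (induction n arbitrary: x)
    case (Suc n)
    let ?u = "\<lambda>y. \<Sum>t<n. hit Q S (\<lambda>y. indicator S y * c) t y"
    have "(\<Sum>t<Suc n. hit Q S (\<lambda>y. indicator S y * c) t x)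
      = (\<integral>\<^sup>+y. indicator S y * c + indicator (-S) y * ?u y \<partial>Q x)"
      by (subst sum.lessThan_Suc_shift)
        (simp add: nn_integral_add nn_integral_indicator_sum)
    also have "\<dots> \<le> (\<integral>\<^sup>+y. c \<partial>Q x)"
      using Suc by (intro nn_integral_mono) (auto simp: indicator_def)
    finally show ?case by simp
  qed simp
  show ?thesis
    by (rule suminf_le_const[OF summableI partial])
qed

end

subsection \<open>Pre-equilibria\<close>

text \<open>Extended nonnegative values let sums and integrals be exchanged freely.
  \<open>C_finite\<close> makes \<open>d 1 ^ n * C\<close> tend to 0, and second countability serves
  Lindelof's theorem.\<close>

locale discounted_stopping = transition Q
  for Q :: "'x::second_countable_topology \<Rightarrow> 'x measure" +
  fixes d :: "nat \<Rightarrow> ennreal"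
    and f :: "'x \<Rightarrow> ennreal"
    and C :: ennreal
  assumes f_measurable [measurable]: "f \<in> borel_measurable borel"
    and f_le: "f x \<le> C" and C_finite: "C < \<infinity>"
    and d_le: "d (Suc k) \<le> d 1" and d_1: "d 1 < 1"
    and d_mult: "d i * d j \<le> d (i + j)"
begin

text \<open>If \<open>g\<close> vanishes off \<open>S\<close>, this is the expected discounted value of \<open>g\<close> at the first visit
  to \<open>S\<close> after time 0.\<close>

definition W :: "'x set \<Rightarrow> ('x \<Rightarrow> ennreal) \<Rightarrow> 'x \<Rightarrow> ennreal" where
  "W S g x = (\<Sum>t. d (Suc t) * hit Q S g t x)"

text \<open>The kernel form of \<open>J P X \<delta> f x (\<rho> X x S)\<close>; the two are
  identified in \<open>ennreal_J_eq\<close>.\<close>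

definition payoff :: "'x set \<Rightarrow> 'x \<Rightarrow> ennreal" where
  "payoff S = W S (\<lambda>y. indicator S y * f y)"

lemma W_measurable [measurable]:
  assumes [measurable]: "S \<in> sets borel" "g \<in> borel_measurable borel"
  shows "W S g \<in> borel_measurable borel"
  unfolding W_def[abs_def] by measurable

lemma payoff_measurable [measurable]:
  assumes [measurable]: "S \<in> sets borel"
  shows "payoff S \<in> borel_measurable borel"
  unfolding payoff_def by measurable

lemma W_mono:
  assumes "\<And>y. g y \<le> h y"
  shows "W S g x \<le> W S h x"
  unfolding W_def using assms
  by (intro suminf_le summableI mult_left_mono hit_mono) auto

lemma W_add:
  assumes [measurable]: "S \<in> sets borel" "g \<in> borel_measurable borel" "h \<in> borel_measurable borel"
  shows "W S (\<lambda>y. g y + h y) x = W S g x + W S h x"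
  unfolding W_def by (simp add: hit_add distrib_left suminf_add[OF summableI summableI])

text \<open>Source of the contraction factor: visits count from time 1 on, so every discount is at
  most \<open>d 1\<close>, and the first-visit probabilities add up to at most 1.\<close>

lemma W_const_le:
  assumes "S \<in> sets borel"
  shows "W S (\<lambda>y. indicator S y * c) x \<le> d 1 * c"
proof -
  have "W S (\<lambda>y. indicator S y * c) x
    \<le> (\<Sum>t. d 1 * hit Q S (\<lambda>y. indicator S y * c) t x)"
    unfolding W_def by (intro suminf_le summableI mult_right_mono d_le) auto
  also have "\<dots> \<le> d 1 * c"
    using hit_total_le[OF assms] by (simp add: mult_left_mono)
  finally show ?thesis .
qed

lemma payoff_le: "S \<in> sets borel \<Longrightarrow> payoff S x \<le> C"
proof -
  assume S: "S \<in> sets borel"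
  have "payoff S x \<le> W S (\<lambda>y. indicator S y * C) x"
    unfolding payoff_def by (intro W_mono mult_left_mono f_le) auto
  also have "\<dots> \<le> d 1 * C" by (rule W_const_le[OF S])
  also have "\<dots> \<le> C" using mult_right_mono[of "d 1" 1 C] d_1 by simp
  finally show ?thesis .
qed

text \<open>The only place where \<open>d i * d j \<le> d (i + j)\<close> enters: waiting for \<open>R\<close> is
  at least as good as restarting the clock at the first visit to \<open>S\<close>.\<close>

lemma payoff_restart:
  assumes [measurable]: "R \<in> sets borel" "S \<in> sets borel" and "R \<subseteq> S"
  shows "W S (\<lambda>y. indicator R y * f y + indicator (S - R) y * payoff R y) x \<le> payoff R x"
proof -
  let ?g = "\<lambda>y. indicator R y * f y"
  let ?h = "\<lambda>s y. indicator (S - R) y * hit Q R ?g s y"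
  have "W S (\<lambda>y. indicator (S - R) y * payoff R y) x
    = (\<Sum>t. d (Suc t) * hit Q S (\<lambda>y. \<Sum>s. d (Suc s) * ?h s y) t x)"
    unfolding payoff_def W_def by (simp flip: ennreal_suminf_cmult add: mult.left_commute)
  also have "\<dots> = (\<Sum>t. \<Sum>s. d (Suc t) * d (Suc s) * hit Q S (?h s) t x)"
    by (simp add: hit_suminf hit_cmult mult.assoc)
  also have "\<dots> \<le> (\<Sum>t. \<Sum>s. d (Suc (Suc (t + s))) * hit Q S (?h s) t x)"
    using d_mult[of "Suc _" "Suc _"] by (intro suminf_le summableI mult_right_mono) auto
  \<comment> \<open>Group by the total waiting time; for \<open>t < n\<close> the discount becomes
    \<open>d (Suc n)\<close> and no longer depends on \<open>t\<close>.\<close>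
  also have "\<dots> = (\<Sum>n. \<Sum>t<n. d (Suc (Suc (t + (n - Suc t)))) * hit Q S (?h (n - Suc t)) t x)"
    by (rule suminf_convolution_ennreal[symmetric])
  also have "\<dots> = (\<Sum>n. d (Suc n) * (\<Sum>t<n. hit Q S (?h (n - Suc t)) t x))"
    unfolding sum_distrib_left by (intro suminf_cong sum.cong) auto
  finally have "W S ?g x + W S (\<lambda>y. indicator (S - R) y * payoff R y) x
    \<le> W S ?g x + (\<Sum>n. d (Suc n) * (\<Sum>t<n. hit Q S (?h (n - Suc t)) t x))"
    by (rule add_left_mono)
  \<comment> \<open>These are the two parts of \<open>hit_subset\<close>, weighted by
    \<open>d (Suc n)\<close> and summed over \<open>n\<close>.\<close>
  also have "\<dots> = payoff R x"
    unfolding payoff_def W_def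
    by (subst (2) hit_subset[OF _ _ _ \<open>R \<subseteq> S\<close>])
      (simp_all add: distrib_left suminf_add[OF summableI summableI])
  finally show ?thesis by (simp add: W_add)
qed

text \<open>The possible gain \<open>c\<close> of any set in the family over \<open>R\<close> shrinks to \<open>d 1 * c\<close>, since it
  can only be realised after the first visit, hence must vanish.\<close>

lemma payoff_improve:
  assumes R: "R \<in> sets borel"
    and F: "\<And>S. S \<in> \<F> \<Longrightarrow> S \<in> sets borel" "\<And>S. S \<in> \<F> \<Longrightarrow> R \<subseteq> S"
    and better: "\<And>S y. S \<in> \<F> \<Longrightarrow> y \<in> S - R \<Longrightarrow> \<exists>T\<in>\<F>. f y \<le> payoff T y"
    and "S \<in> \<F>"
  shows "payoff S x \<le> payoff R x"
proof -
  \<comment> \<open>The contraction is iterated from the crude bound \<open>C\<close>, uniformly in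
    the set and the point, because the step passes from \<open>S\<close> to other members of the
    family.\<close>
  have contract: "payoff S x \<le> payoff R x + d 1 ^ n * C" if "S \<in> \<F>" for n S x
    using that
  proof (induction n arbitrary: S x)
    case 0
    then show ?case using payoff_le[OF F(1)] by (auto intro: add_increasing)
  next
    case (Suc n)
    note [measurable] = R F(1)[OF Suc.prems]
    let ?c = "d 1 ^ n * C"
    \<comment> \<open>On \<open>S - R\<close> some \<open>T\<close> in the family pays at least
      \<open>f y\<close>, and the induction hypothesis for \<open>T\<close> bounds that by
      \<open>payoff R y + ?c\<close>; on \<open>R\<close> the first term is already
      \<open>f y\<close>.\<close>
    have pointwise: "indicator S y * f y
      \<le> (indicator R y * f y + indicator (S - R) y * payoff R y) + indicator S y * ?c" for y
    proof (cases "y \<in> S - R")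
      case True
      then obtain T where "T \<in> \<F>" "f y \<le> payoff T y" using better Suc.prems by blast
      with Suc.IH[OF this(1), of y] True show ?thesis by simp
    next
      case False
      then show ?thesis using F(2)[OF Suc.prems] by (auto simp: indicator_def)
    qed
    have "payoff S x \<le> W S (\<lambda>y. (indicator R y * f y + indicator (S - R) y * payoff R y)
      + indicator S y * ?c) x"
      unfolding payoff_def[of S] by (rule W_mono[OF pointwise])
    also have "\<dots> \<le> payoff R x + d 1 * ?c"
      using payoff_restart[OF _ _ F(2)[OF Suc.prems]] W_const_le[of S]
      by (subst W_add) (auto intro!: add_mono)
    finally show ?case by (simp add: mult.assoc)
  qed
  obtain r where r: "d 1 = ennreal r" "0 \<le> r" "r < 1"
    using d_1 by (cases "d 1") auto
  obtain b where b: "C = ennreal b" "0 \<le> b"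
    using C_finite by (cases C) auto
  have "(\<lambda>n. r ^ n * b) \<longlonglongrightarrow> 0"
    using LIMSEQ_realpow_zero[OF r(2,3)] tendsto_mult_left_zero by blast
  then have "(\<lambda>n. d 1 ^ n * C) \<longlonglongrightarrow> 0"
    using r b by (simp add: ennreal_power flip: ennreal_mult ennreal_0)
  then have "(\<lambda>n. payoff R x + d 1 ^ n * C) \<longlonglongrightarrow> payoff R x + 0"
    by (intro tendsto_add tendsto_const)
  then show ?thesis
    using contract[OF \<open>S \<in> \<F>\<close>] by (intro LIMSEQ_le_const) auto
qed

section \<open>Pre-equilibria and their intersection\<close>

definition pre_equilibria :: "'x set set" where
  "pre_equilibria = {S \<in> sets borel. {x. payoff S x \<le> f x} \<subseteq> S}"

text \<open>Points of \<open>S\<close> outside the region strictly prefer continuing, so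
  \<open>payoff_improve\<close> shows that the region pays at least as much as \<open>S\<close>. A
  larger payoff leaves fewer points that prefer stopping.\<close>

lemma stopping_region_pre_equilibrium:
  assumes "S \<in> pre_equilibria"
  shows "{x. payoff S x \<le> f x} \<in> pre_equilibria"
proof -
  let ?R = "{x. payoff S x \<le> f x}"
  have [measurable]: "S \<in> sets borel" and RS: "?R \<subseteq> S" using assms by (auto simp: pre_equilibria_def)
  have R: "?R \<in> sets borel" by measurable
  have "payoff S x \<le> payoff ?R x" for x
    using RS by (intro payoff_improve[OF R, of "{S}"]) auto
  with R show ?thesis unfolding pre_equilibria_def by (auto intro: order_trans)
qed

text \<open>Puts the payoff into the form of one integral against \<open>Q x\<close> whose integrand
  does not depend on \<open>x\<close>, as the Feller condition requires.\<close>

lemma payoff_expand: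
  assumes [measurable]: "S \<in> sets borel"
  shows "payoff S x = (\<integral>\<^sup>+y. d 1 * (indicator S y * f y)
    + indicator (-S) y * (\<Sum>t. d (Suc (Suc t)) * hit Q S (\<lambda>y. indicator S y * f y) t y) \<partial>Q x)"
proof -
  let ?g = "\<lambda>y. indicator S y * f y"
  have "payoff S x = (\<Sum>t. d (Suc (t + 1)) * hit Q S ?g (t + 1) x) + d 1 * hit Q S ?g 0 x"
    unfolding payoff_def W_def by (subst suminf_offset[where i = 1]) simp_all
  also have "(\<Sum>t. d (Suc (t + 1)) * hit Q S ?g (t + 1) x)
    = (\<integral>\<^sup>+y. indicator (-S) y * (\<Sum>t. d (Suc (Suc t)) * hit Q S ?g t y) \<partial>Q x)"
  proof -
    have "(\<Sum>t. d (Suc (t + 1)) * hit Q S ?g (t + 1) x)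
      = (\<Sum>t. \<integral>\<^sup>+y. d (Suc (Suc t)) * (indicator (-S) y * hit Q S ?g t y) \<partial>Q x)"
      by (simp add: nn_integral_cmult)
    also have "\<dots> = (\<integral>\<^sup>+y. (\<Sum>t. d (Suc (Suc t)) * (indicator (-S) y * hit Q S ?g t y)) \<partial>Q x)"
      by (rule nn_integral_suminf[symmetric]) measurable
    finally show ?thesis
      by (simp only: mult.left_commute[of _ "indicator (-S) _"] ennreal_suminf_cmult)
  qed
  finally show ?thesis
    by (simp add: nn_integral_add nn_integral_cmult add.commute)
qed

lemma open_payoff_greater:
  assumes feller: "\<And>g q. g \<in> borel_measurable borel \<Longrightarrow> (\<And>y. g y \<le> C) \<Longrightarrow>
      open {x. q < (\<integral>\<^sup>+y. g y \<partial>Q x)}"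
    and S [measurable]: "S \<in> sets borel"
  shows "open {x. q < payoff S x}"
proof -
  let ?g = "\<lambda>y. indicator S y * f y"
  let ?H = "\<lambda>y. d 1 * ?g y + indicator (-S) y * (\<Sum>t. d (Suc (Suc t)) * hit Q S ?g t y)"
  have d1C: "d 1 * C \<le> C" using mult_right_mono[of "d 1" 1 C] d_1 by simp
  \<comment> \<open>Only one summand of \<open>?H\<close> survives at each point: the first on
    \<open>S\<close>, the series off \<open>S\<close>. Each is at most
    \<open>d 1 * C\<close>.\<close>
  have "?H y \<le> C" for y
  proof -
    have "(\<Sum>t. d (Suc (Suc t)) * hit Q S ?g t y)
      \<le> (\<Sum>t. d 1 * hit Q S (\<lambda>y. indicator S y * C) t y)"
      by (intro suminf_le summableI mult_mono d_le hit_mono f_le) auto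
    also have "\<dots> \<le> C"
      using mult_left_mono[OF hit_total_le[OF S, of C y], of "d 1"] d1C by simp
    finally show ?thesis
      using mult_left_mono[OF f_le[of y], of "d 1"] d1C
      by (cases "y \<in> S") simp_all
  qed
  moreover have "?H \<in> borel_measurable borel" by measurable
  ultimately have "open {x. q < (\<integral>\<^sup>+y. ?H y \<partial>Q x)}" by (rule feller[rotated])
  then show ?thesis by (simp only: payoff_expand[OF S])
qed

lemma Inter_pre_equilibria:
  assumes feller: "\<And>g q. g \<in> borel_measurable borel \<Longrightarrow> (\<And>y. g y \<le> C) \<Longrightarrow>
      open {x. q < (\<integral>\<^sup>+y. g y \<partial>Q x)}"
  defines "R \<equiv> \<Inter>pre_equilibria"
  shows "R \<in> sets borel" and "{x. payoff R x \<le> f x} = R"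
    and "\<And>S x. S \<in> pre_equilibria \<Longrightarrow> payoff S x \<le> payoff R x"
proof -
  have in_borel: "S \<in> sets borel" if "S \<in> pre_equilibria" for S using that by (simp add: pre_equilibria_def)
  have not_in_R: "\<exists>T\<in>pre_equilibria. f y < payoff T y" if "y \<notin> R" for y
  proof -
    obtain S where "S \<in> pre_equilibria" "y \<notin> S" using \<open>y \<notin> R\<close> unfolding R_def by blast
    then show ?thesis by (force simp: pre_equilibria_def)
  qed
  \<comment> \<open>The stopping region of \<open>T\<close> is again a pre-equilibrium, so it
    contains the intersection \<open>R\<close>.\<close>
  have in_R: "payoff T y \<le> f y" if "T \<in> pre_equilibria" "y \<in> R" for T y
    using that stopping_region_pre_equilibrium by (auto simp: R_def)
  \<comment> \<open>Lindelof needs open sets, and \<open>{x. f x < payoff S x}\<close> need not be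
    open. Superlevel sets at a fixed \<open>q\<close> are, and countably many levels in
    \<open>D\<close> separate \<open>f x\<close> from \<open>payoff S x\<close>.\<close>
  obtain D :: "ennreal set" where "countable D"
    and D: "\<And>U. open U \<Longrightarrow> U \<noteq> {} \<Longrightarrow> \<exists>q\<in>D. q \<in> U"
    using countable_dense_setE by metis
  have "\<exists>\<G>. countable \<G> \<and> \<G> \<subseteq> pre_equilibria \<and>
      (\<Union>S\<in>\<G>. {x. q < payoff S x}) = (\<Union>S\<in>pre_equilibria. {x. q < payoff S x})" for q
  proof -
    have "open U" if "U \<in> (\<lambda>S. {x. q < payoff S x}) ` pre_equilibria" for U
      using that open_payoff_greater[OF feller in_borel] by blast
    then obtain \<U> where "\<U> \<subseteq> (\<lambda>S. {x. q < payoff S x}) ` pre_equilibria" "countable \<U>"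
      "\<Union>\<U> = (\<Union>S\<in>pre_equilibria. {x. q < payoff S x})"
      by (rule Lindelof)
    then obtain \<G> where "countable \<G>" "\<G> \<subseteq> pre_equilibria" "\<U> = (\<lambda>S. {x. q < payoff S x}) ` \<G>"
      using countable_subset_image[of \<U> "\<lambda>S. {x. q < payoff S x}" pre_equilibria] by blast
    with \<open>\<Union>\<U> = _\<close> show ?thesis by blast
  qed
  then obtain \<G> where \<G>: "\<And>q. countable (\<G> q)" "\<And>q. \<G> q \<subseteq> pre_equilibria"
    "\<And>q. (\<Union>S\<in>\<G> q. {x. q < payoff S x}) = (\<Union>S\<in>pre_equilibria. {x. q < payoff S x})"
    by metis
  let ?\<H> = "\<Union>q\<in>D. \<G> q"
  have "- R = (\<Union>S\<in>?\<H>. {x. f x < payoff S x})"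
  proof (intro set_eqI iffI)
    fix x assume "x \<in> - R"
    then obtain S where S: "S \<in> pre_equilibria" "f x < payoff S x" using not_in_R by auto
    then have "{f x<..<payoff S x} \<noteq> {}" using dense by auto
    then obtain q where q: "q \<in> D" "f x < q" "q < payoff S x"
      using D[of "{f x<..<payoff S x}"] by auto
    then have "x \<in> (\<Union>S\<in>\<G> q. {x. q < payoff S x})" using S \<G>(3) by blast
    then show "x \<in> (\<Union>S\<in>?\<H>. {x. f x < payoff S x})"
      using q by (auto intro: less_trans)
  next
    fix x assume "x \<in> (\<Union>S\<in>?\<H>. {x. f x < payoff S x})"
    then obtain S where "S \<in> pre_equilibria" "f x < payoff S x" using \<G>(2) by blast
    then show "x \<in> - R" using in_R[of S x] by auto
  qed
  moreover have "(\<Union>S\<in>?\<H>. {x. f x < payoff S x}) \<in> sets borel"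
  proof (rule sets.countable_UN'')
    show "countable ?\<H>" using \<open>countable D\<close> \<G>(1) by blast
    show "{x. f x < payoff S x} \<in> sets borel" if "S \<in> ?\<H>" for S
    proof -
      have [measurable]: "S \<in> sets borel" using that \<G>(2) in_borel by blast
      show ?thesis by measurable
    qed
  qed
  ultimately have "- R \<in> sets borel" by simp
  then show R: "R \<in> sets borel" by (metis borel_comp double_compl)
  show improve: "payoff S x \<le> payoff R x" if "S \<in> pre_equilibria" for S x
  proof (rule payoff_improve[OF R, of pre_equilibria])
    show "\<exists>T\<in>pre_equilibria. f y \<le> payoff T y" if "y \<in> S - R" for S y
      using not_in_R[of y] that by (auto intro: less_imp_le)
  qed (use that in_borel in \<open>auto simp: R_def\<close>)
  have "R \<in> pre_equilibria"
  proof -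
    have "x \<in> R" if "payoff R x \<le> f x" for x
      using not_in_R[of x] improve that by (meson leD order_trans)
    with R show ?thesis by (auto simp: pre_equilibria_def)
  qed
  \<comment> \<open>Since \<open>R\<close> is itself a pre-equilibrium, \<open>in_R\<close> applies
    to \<open>R\<close> and gives the remaining inclusion.\<close>
  then show "{x. payoff R x \<le> f x} = R"
    using in_R[of R] by (auto simp: pre_equilibria_def)
qed

end

subsection \<open>From the Markov process to its kernel\<close>

lemma subalgebra_natural_filtration:
  assumes "\<And>t. X t \<in> borel_measurable M"
  shows "subalgebra M (natural_filtration M X t)"
  unfolding subalgebra_def natural_filtration_def
  using measurable_sets[OF assms]
  by (subst sets_measure_of) (auto simp: space_measure_of_conv intro!: sets.sigma_sets_subset)

lemma natural_filtration_measurable: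
  assumes "s \<le> t"
  shows "X s \<in> borel_measurable (natural_filtration M X t)"
proof (rule measurableI)
  fix A :: "'b set" assume "A \<in> sets borel"
  then have "X s -` A \<inter> space M \<in> {X s -` A \<inter> space M | s A. s \<le> t \<and> A \<in> sets borel}"
    using assms by blast
  then show "X s -` A \<inter> space (natural_filtration M X t) \<in> sets (natural_filtration M X t)"
    unfolding natural_filtration_def space_measure_of_conv by (subst sets_measure_of) auto
qed simp

text \<open>For indicators this is the defining property of conditional expectation on the past
  event \<open>A\<close>. Linearity and monotone limits carry it to all nonnegative Borel
  functions.\<close>

lemma markov_process_nn_integral:
  fixes Q :: "'x::topological_space \<Rightarrow> 'x measure"
  assumes Q: "Q \<in> borel \<rightarrow>\<^sub>M prob_algebra borel"
    and mp: "markov_process M X Q"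
    and A: "A \<in> sets (natural_filtration M X t)"
    and g: "g \<in> borel_measurable borel"
  shows "(\<integral>\<^sup>+\<omega>. indicator A \<omega> * g (X (Suc t) \<omega>) \<partial>M)
    = (\<integral>\<^sup>+\<omega>. indicator A \<omega> * (\<integral>\<^sup>+y. g y \<partial>Q (X t \<omega>)) \<partial>M)"
proof -
  interpret prob_space M using mp by (simp add: markov_process_def)
  have X [measurable]: "X s \<in> borel_measurable M" for s
    using mp by (simp add: markov_process_def)
  let ?F = "natural_filtration M X t"
  interpret finite_measure_subalgebra M ?F
    by unfold_locales (rule subalgebra_natural_filtration[OF X])
  have AM [measurable]: "A \<in> sets M" using subalg A by (auto simp: subalgebra_def)
  interpret transition Q by unfold_locales (rule Q)
  have probQ: "prob_space (Q x)" for x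
    using measurable_space[OF Q, of x] by (simp add: space_prob_algebra)
  from g show ?thesis
  proof (induction rule: borel_measurable_induct)
    case (cong f g)
    then show ?case by (metis (no_types, lifting) UNIV_I ext space_borel)
  next
    case (set B)
    note [measurable] = set
    have [measurable]: "(\<lambda>x. measure (Q x) B) \<in> borel_measurable borel"
      using borel_measurable_Q[of "indicator B"] by (simp add: measure_def)
    let ?c = "\<lambda>\<omega>. measure (Q (X t \<omega>)) B"
    have int: "integrable M (\<lambda>\<omega>. indicator B (X (Suc t) \<omega>) :: real)"
      by (rule integrable_const_bound[where B = 1]) (auto simp: indicator_def)
    have c_int: "integrable M (\<lambda>\<omega>. indicator A \<omega> * ?c \<omega>)"
      by (rule integrable_const_bound[where B = 1])
        (auto simp: indicator_def prob_space.prob_le_1[OF probQ])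
    have i_int: "integrable M (\<lambda>\<omega>. indicator A \<omega> * indicator B (X (Suc t) \<omega>) :: real)"
      by (rule integrable_const_bound[where B = 1]) (auto simp: indicator_def)
    have "(\<integral>\<omega>. indicator A \<omega> * indicator B (X (Suc t) \<omega>) \<partial>M)
      = (\<integral>\<omega>. indicator A \<omega> * real_cond_exp M ?F (\<lambda>\<omega>. indicator B (X (Suc t) \<omega>)) \<omega> \<partial>M)"
      using real_cond_exp_intA[OF int A] by (simp add: set_lebesgue_integral_def)
    also have "\<dots> = (\<integral>\<omega>. indicator A \<omega> * ?c \<omega> \<partial>M)"
    proof (rule integral_cong_AE)
      have "AE \<omega> in M. real_cond_exp M ?F (\<lambda>\<omega>. indicator B (X (Suc t) \<omega>)) \<omega> = ?c \<omega>"
        using mp set by (simp add: markov_process_def)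
      then show "AE \<omega> in M. indicator A \<omega> * real_cond_exp M ?F (\<lambda>\<omega>. indicator B (X (Suc t) \<omega>)) \<omega>
        = indicator A \<omega> * ?c \<omega>" by eventually_elim simp
    qed measurable
    finally have eq: "(\<integral>\<omega>. indicator A \<omega> * indicator B (X (Suc t) \<omega>) \<partial>M)
      = (\<integral>\<omega>. indicator A \<omega> * ?c \<omega> \<partial>M)" .
    have "(\<integral>\<^sup>+\<omega>. indicator A \<omega> * indicator B (X (Suc t) \<omega>) \<partial>M)
      = (\<integral>\<^sup>+\<omega>. ennreal (indicator A \<omega> * indicator B (X (Suc t) \<omega>)) \<partial>M)"
      by (intro nn_integral_cong) (auto simp: indicator_def)
    also have "\<dots> = (\<integral>\<^sup>+\<omega>. ennreal (indicator A \<omega> * ?c \<omega>) \<partial>M)"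
      using nn_integral_eq_integral[OF i_int] nn_integral_eq_integral[OF c_int] eq by simp
    also have "\<dots> = (\<integral>\<^sup>+\<omega>. indicator A \<omega> * (\<integral>\<^sup>+y. indicator B y \<partial>Q (X t \<omega>)) \<partial>M)"
      by (intro nn_integral_cong)
        (auto simp: indicator_def[of A] finite_measure.emeasure_eq_measure
          prob_space.finite_measure[OF probQ])
    finally show ?case .
  next
    case (mult u c)
    note [measurable] = \<open>u \<in> borel_measurable borel\<close>
    have "(\<integral>\<^sup>+y. c * u y \<partial>Q z) = c * (\<integral>\<^sup>+y. u y \<partial>Q z)" for z
      by (simp add: nn_integral_cmult)
    then show ?case
      by (simp add: mult.IH nn_integral_cmult mult.left_commute[of _ c])
  next
    case (add u v)
    note [measurable] = \<open>u \<in> borel_measurable borel\<close> \<open>v \<in> borel_measurable borel\<close>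
    have "(\<integral>\<^sup>+y. v y + u y \<partial>Q z) = (\<integral>\<^sup>+y. v y \<partial>Q z) + (\<integral>\<^sup>+y. u y \<partial>Q z)" for z
      by (simp add: nn_integral_add)
    then show ?case
      by (simp add: add.IH nn_integral_add distrib_left)
  next
    case (seq U)
    note [measurable] = seq.hyps(1)
    have inc: "incseq (\<lambda>i. U i x)" for x
      using seq.hyps by (auto simp: incseq_def le_fun_def)
    have "(\<integral>\<^sup>+\<omega>. indicator A \<omega> * (SUP i. U i) (X (Suc t) \<omega>) \<partial>M)
      = (\<integral>\<^sup>+\<omega>. (SUP i. indicator A \<omega> * U i (X (Suc t) \<omega>)) \<partial>M)"
      by (simp add: SUP_mult_left_ennreal image_comp)
    also have "\<dots> = (SUP i. \<integral>\<^sup>+\<omega>. indicator A \<omega> * U i (X (Suc t) \<omega>) \<partial>M)"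
      using inc by (intro nn_integral_monotone_convergence_SUP)
        (auto simp: incseq_def le_fun_def intro!: mult_left_mono)
    also have "\<dots> = (SUP i. \<integral>\<^sup>+\<omega>. indicator A \<omega> * (\<integral>\<^sup>+y. U i y \<partial>Q (X t \<omega>)) \<partial>M)"
      by (simp add: seq.IH)
    also have "\<dots> = (\<integral>\<^sup>+\<omega>. (SUP i. indicator A \<omega> * (\<integral>\<^sup>+y. U i y \<partial>Q (X t \<omega>))) \<partial>M)"
      using inc by (intro nn_integral_monotone_convergence_SUP[symmetric])
        (auto simp: incseq_def le_fun_def intro!: mult_left_mono nn_integral_mono)
    also have "\<dots> = (\<integral>\<^sup>+\<omega>. indicator A \<omega> * (SUP i. \<integral>\<^sup>+y. U i y \<partial>Q (X t \<omega>)) \<partial>M)"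
      by (simp add: SUP_mult_left_ennreal image_comp)
    also have "\<dots> = (\<integral>\<^sup>+\<omega>. indicator A \<omega> * (\<integral>\<^sup>+y. (SUP i. U i) y \<partial>Q (X t \<omega>)) \<partial>M)"
    proof (intro nn_integral_cong arg_cong2[where f = times] refl)
      fix \<omega>
      show "(SUP i. \<integral>\<^sup>+y. U i y \<partial>Q (X t \<omega>)) = (\<integral>\<^sup>+y. (SUP i. U i) y \<partial>Q (X t \<omega>))"
        using seq.hyps(3) unfolding SUP_apply
        by (intro nn_integral_monotone_convergence_SUP[symmetric]) simp_all
    qed
    finally show ?case .
  qed
qed

text \<open>Time 0 is left out because \<open>\<rho>\<close> counts visits from time 1 on; a start
  inside \<open>S\<close> is no visit.\<close>

definition avoids :: "'w measure \<Rightarrow> (nat \<Rightarrow> 'w \<Rightarrow> 'x) \<Rightarrow> 'x set \<Rightarrow> nat \<Rightarrow> 'w set" where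
  "avoids M X S t = {\<omega> \<in> space M. \<forall>s\<in>{1..t}. X s \<omega> \<notin> S}"

lemma avoids_sets:
  assumes S: "S \<in> sets borel"
  shows "avoids M X S t \<in> sets (natural_filtration M X t)"
proof -
  have "{\<omega> \<in> space (natural_filtration M X t). \<forall>s\<in>{1..t}. X s \<omega> \<notin> S}
    \<in> sets (natural_filtration M X t)"
  proof (rule sets.sets_Collect_finite_All)
    fix s assume "s \<in> {1..t}"
    then have [measurable]: "X s \<in> borel_measurable (natural_filtration M X t)"
      by (intro natural_filtration_measurable) simp
    show "{\<omega> \<in> space (natural_filtration M X t). X s \<omega> \<notin> S} \<in> sets (natural_filtration M X t)"
      using S by measurable
  qed simp
  then show ?thesis by (simp add: avoids_def natural_filtration_def space_measure_of_conv)
qed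

text \<open>The Markov property integrates out the last step, replacing \<open>g\<close> by a new
  function on the state one step earlier; hence the induction over all \<open>g\<close>. The base
  case uses the starting point.\<close>

lemma nn_integral_avoids_eq_hit:
  fixes Q :: "'x::topological_space \<Rightarrow> 'x measure"
  assumes Q: "Q \<in> borel \<rightarrow>\<^sub>M prob_algebra borel"
    and mp: "markov_process M X Q" and start: "AE \<omega> in M. X 0 \<omega> = x"
    and S [measurable]: "S \<in> sets borel" and "g \<in> borel_measurable borel"
  shows "(\<integral>\<^sup>+\<omega>. indicator (avoids M X S t) \<omega> * g (X (Suc t) \<omega>) \<partial>M) = hit Q S g t x"
  using \<open>g \<in> borel_measurable borel\<close>
proof (induction t arbitrary: g)
  case 0
  interpret prob_space M using mp by (simp add: markov_process_def)
  have "(\<integral>\<^sup>+\<omega>. indicator (avoids M X S 0) \<omega> * g (X (Suc 0) \<omega>) \<partial>M)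
    = (\<integral>\<^sup>+\<omega>. indicator (avoids M X S 0) \<omega> * (\<integral>\<^sup>+y. g y \<partial>Q (X 0 \<omega>)) \<partial>M)"
    by (rule markov_process_nn_integral[OF Q mp avoids_sets[OF S] 0])
  also have "\<dots> = (\<integral>\<^sup>+\<omega>. (\<integral>\<^sup>+y. g y \<partial>Q x) \<partial>M)"
    using start by (intro nn_integral_cong_AE) (auto simp: avoids_def)
  finally show ?case by (simp add: emeasure_space_1)
next
  case (Suc t)
  interpret transition Q by unfold_locales (rule Q)
  note [measurable] = Suc.prems
  let ?h = "\<lambda>y. indicator (-S) y * (\<integral>\<^sup>+z. g z \<partial>Q y)"
  have "(\<integral>\<^sup>+\<omega>. indicator (avoids M X S (Suc t)) \<omega> * g (X (Suc (Suc t)) \<omega>) \<partial>M)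
    = (\<integral>\<^sup>+\<omega>. indicator (avoids M X S (Suc t)) \<omega> * (\<integral>\<^sup>+y. g y \<partial>Q (X (Suc t) \<omega>)) \<partial>M)"
    by (rule markov_process_nn_integral[OF Q mp avoids_sets[OF S] Suc.prems])
  also have "\<dots> = (\<integral>\<^sup>+\<omega>. indicator (avoids M X S t) \<omega> * ?h (X (Suc t) \<omega>) \<partial>M)"
    by (intro nn_integral_cong) (auto simp: avoids_def indicator_def atLeastAtMostSuc_conv)
  also have "\<dots> = hit Q S ?h t x" by (rule Suc.IH) measurable
  \<comment> \<open>\<open>hit\<close> recurses on the first step, while the last one was removed
    here; an inner induction reconciles the two orders.\<close>
  also have "\<dots> = hit Q S g (Suc t) x" by (induction t arbitrary: x) simp_all
  finally show ?case .
qed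

text \<open>Only the term of the first visit is nonzero. Without a visit every term vanishes,
  matching the payoff 0 at time \<infinity>.\<close>

lemma discounted_payoff_eq_suminf:
  fixes f :: "'x \<Rightarrow> real"
  assumes "\<omega> \<in> space M" and "\<And>k. 0 \<le> \<delta> k"
  shows "ennreal (discounted_payoff \<delta> f (X x) (\<rho> X x S) \<omega>)
    = (\<Sum>t. ennreal (\<delta> (Suc t)) * (indicator (avoids M (X x) S t) \<omega>
        * (indicator S (X x (Suc t) \<omega>) * ennreal (f (X x (Suc t) \<omega>)))))"
proof (cases "\<exists>t. X x (Suc t) \<omega> \<in> S")
  case False
  then have "{enat t | t. t \<ge> 1 \<and> X x t \<omega> \<in> S} = {}"
    by (auto simp: Suc_le_eq gr0_conv_Suc)
  then have "\<rho> X x S \<omega> = \<infinity>" unfolding \<rho>_def by (metis Inf_empty top_enat_def)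
  with False show ?thesis by (simp add: discounted_payoff_def)
next
  case True
  define m where "m = (LEAST t. X x (Suc t) \<omega> \<in> S)"
  have m: "X x (Suc m) \<omega> \<in> S" unfolding m_def using True by (rule LeastI_ex)
  have m_le: "m \<le> t" if "X x (Suc t) \<omega> \<in> S" for t
    unfolding m_def using that by (rule Least_le)
  have "\<rho> X x S \<omega> = enat (Suc m)"
    unfolding \<rho>_def
  proof (rule Inf_eqI)
    fix i assume "i \<in> {enat t | t. t \<ge> 1 \<and> X x t \<omega> \<in> S}"
    then obtain t where "i = enat (Suc t)" "X x (Suc t) \<omega> \<in> S"
      by (auto simp: Suc_le_eq gr0_conv_Suc)
    with m_le show "enat (Suc m) \<le> i" by simp
  next
    fix y assume "\<And>i. i \<in> {enat t | t. t \<ge> 1 \<and> X x t \<omega> \<in> S} \<Longrightarrow> y \<le> i"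
    then show "y \<le> enat (Suc m)" using m by auto
  qed
  moreover have "\<omega> \<in> avoids M (X x) S m"
    using \<open>\<omega> \<in> space M\<close> m_le by (fastforce simp: avoids_def Suc_le_eq gr0_conv_Suc)
  \<comment> \<open>For \<open>t < m\<close> there is no visit at time \<open>t + 1\<close> by
    minimality; for \<open>t > m\<close> the visit at time \<open>m + 1\<close> violates
    avoidance.\<close>
  moreover have "\<omega> \<notin> avoids M (X x) S t \<or> X x (Suc t) \<omega> \<notin> S" if "t \<noteq> m" for t
    using that m m_le[of t] by (fastforce simp: avoids_def)
  ultimately show ?thesis
    using m assms(2)
    by (subst suminf_finite[of "{m}"]) (force simp: discounted_payoff_def ennreal_mult')+
qed

text \<open>Finiteness is assumed because the real-valued integral in \<open>J\<close> defaults to 0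
  when the series is infinite.\<close>

lemma ennreal_J_eq:
  fixes Q :: "'x::topological_space \<Rightarrow> 'x measure" and f :: "'x \<Rightarrow> real"
  assumes Q: "Q \<in> borel \<rightarrow>\<^sub>M prob_algebra borel" and fam: "markov_family P X Q"
    and f [measurable]: "f \<in> borel_measurable borel" and f_nonneg: "\<And>y. 0 \<le> f y"
    and \<delta>_nonneg: "\<And>k. 0 \<le> \<delta> k"
    and S [measurable]: "S \<in> sets borel"
    and finite: "(\<Sum>t. ennreal (\<delta> (Suc t)) * hit Q S (\<lambda>y. indicator S y * ennreal (f y)) t x) < \<top>"
  shows "ennreal (J P X \<delta> f x (\<rho> X x S))
    = (\<Sum>t. ennreal (\<delta> (Suc t)) * hit Q S (\<lambda>y. indicator S y * ennreal (f y)) t x)"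
proof -
  have mp: "markov_process (P x) (X x) Q" and start: "AE \<omega> in P x. X x 0 \<omega> = x"
    using fam by (simp_all add: markov_family_def)
  have X [measurable]: "X x t \<in> borel_measurable (P x)" for t
    using mp by (simp add: markov_process_def)
  have [measurable]: "avoids (P x) (X x) S t \<in> sets (P x)" for t
    using avoids_sets[OF S] subalgebra_natural_filtration[of "X x", OF X]
    unfolding subalgebra_def by blast
  let ?Y = "discounted_payoff \<delta> f (X x) (\<rho> X x S)"
  let ?g = "\<lambda>y. indicator S y * ennreal (f y)"
  let ?F = "\<lambda>\<omega>. \<Sum>t. ennreal (\<delta> (Suc t)) * (indicator (avoids (P x) (X x) S t) \<omega> * ?g (X x (Suc t) \<omega>))"
  have YF: "ennreal (?Y \<omega>) = ?F \<omega>" if "\<omega> \<in> space (P x)" for \<omega>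
    by (rule discounted_payoff_eq_suminf[OF that \<delta>_nonneg])
  have Y_nonneg: "0 \<le> ?Y \<omega>" for \<omega>
    using f_nonneg \<delta>_nonneg by (auto simp: discounted_payoff_def split: enat.split)
  \<comment> \<open>Measurability of the payoff at a random time is read off from its
    series.\<close>
  have "?Y \<omega> = enn2real (?F \<omega>)" if "\<omega> \<in> space (P x)" for \<omega>
    unfolding YF[OF that, symmetric] using Y_nonneg by simp
  then have "?Y \<in> borel_measurable (P x) \<longleftrightarrow> (\<lambda>\<omega>. enn2real (?F \<omega>)) \<in> borel_measurable (P x)"
    by (rule measurable_cong)
  moreover have "(\<lambda>\<omega>. enn2real (?F \<omega>)) \<in> borel_measurable (P x)" by measurable
  ultimately have "?Y \<in> borel_measurable (P x)" by blast
  then have "J P X \<delta> f x (\<rho> X x S) = enn2real (\<integral>\<^sup>+\<omega>. ennreal (?Y \<omega>) \<partial>P x)"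
    unfolding J_def using Y_nonneg by (intro integral_eq_nn_integral) auto
  also have "(\<integral>\<^sup>+\<omega>. ennreal (?Y \<omega>) \<partial>P x) = (\<integral>\<^sup>+\<omega>. ?F \<omega> \<partial>P x)"
    by (rule nn_integral_cong) (rule YF)
  also have "\<dots> = (\<Sum>t. ennreal (\<delta> (Suc t)) * hit Q S ?g t x)"
    using nn_integral_avoids_eq_hit[OF Q mp start S, of ?g]
    by (simp add: nn_integral_suminf nn_integral_cmult)
  finally show ?thesis using finite by simp
qed

text \<open>The liminf condition keeps sublevel sets closed under limits of sequences, which
  suffices in a first-countable space.\<close>

lemma open_nn_integral_greater:
  fixes Q :: "'x::{first_countable_topology, t2_space} \<Rightarrow> 'x measure"
  assumes Q: "Q \<in> borel \<rightarrow>\<^sub>M prob_algebra borel"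
    and feller: "\<And>(g :: 'x \<Rightarrow> real) (xs :: nat \<Rightarrow> 'x) x.
           g \<in> borel_measurable borel \<Longrightarrow> bounded (range g) \<Longrightarrow> xs \<longlonglongrightarrow> x \<Longrightarrow>
           liminf (\<lambda>n. ereal (\<integral>y. g y \<partial>Q (xs n))) \<ge> ereal (\<integral>y. g y \<partial>Q x)"
    and g [measurable]: "g \<in> borel_measurable borel" and g_le: "\<And>y. g y \<le> ennreal B"
  shows "open {x. q < (\<integral>\<^sup>+y. g y \<partial>Q x)}"
proof -
  interpret transition Q by unfold_locales (rule Q)
  let ?h = "\<lambda>y. enn2real (g y)"
  have h_le: "?h y \<le> \<bar>B\<bar>" for y
    using g_le[of y] by (intro enn2real_leI order_trans[OF g_le] ennreal_leI) auto
  have g_h: "g y = ennreal (?h y)" for y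
    using le_less_trans[OF g_le[of y] ennreal_less_top] by simp
  have eq: "(\<integral>\<^sup>+y. g y \<partial>Q x) = ennreal (\<integral>y. ?h y \<partial>Q x)" for x
  proof -
    have "finite_measure (Q x)" by (rule finite_measureI) simp
    then have "integrable (Q x) ?h"
      using h_le by (intro finite_measure.integrable_const_bound[where B = "\<bar>B\<bar>"]) auto
    from nn_integral_eq_integral[OF this] show ?thesis by (simp flip: g_h)
  qed
  have "closed {x. (\<integral>\<^sup>+y. g y \<partial>Q x) \<le> q}"
    unfolding closed_sequential_limits
  proof (intro allI impI, elim conjE)
    fix xs x assume xs: "\<forall>n. xs n \<in> {x. (\<integral>\<^sup>+y. g y \<partial>Q x) \<le> q}" "xs \<longlonglongrightarrow> x"
    show "x \<in> {x. (\<integral>\<^sup>+y. g y \<partial>Q x) \<le> q}"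
    proof (cases q)
      case (real r)
      have "bounded (range ?h)"
        using h_le by (intro boundedI[where B = "\<bar>B\<bar>"]) auto
      then have "ereal (\<integral>y. ?h y \<partial>Q x) \<le> liminf (\<lambda>n. ereal (\<integral>y. ?h y \<partial>Q (xs n)))"
        using xs(2) by (intro feller) auto
      also have "\<dots> \<le> liminf (\<lambda>n. ereal r)"
        using xs(1) real by (intro Liminf_mono always_eventually) (simp add: eq ennreal_le_iff)
      finally have "(\<integral>y. ?h y \<partial>Q x) \<le> r" by (simp add: Liminf_const)
      with real show ?thesis by (simp add: eq ennreal_leI)
    qed simp
  qed
  moreover have "{x. q < (\<integral>\<^sup>+y. g y \<partial>Q x)} = - {x. (\<integral>\<^sup>+y. g y \<partial>Q x) \<le> q}" by auto
  ultimately show ?thesis by (simp only: open_Compl)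
qed

subsection \<open>The optimal equilibrium\<close>

theorem theorem4p2:
  fixes P :: "'x::polish_space \<Rightarrow> 'w measure"
    and X :: "'x \<Rightarrow> nat \<Rightarrow> 'w \<Rightarrow> 'x"
    and Q :: "'x \<Rightarrow> 'x measure"
    and f :: "'x \<Rightarrow> real"
    and \<delta> :: "nat \<Rightarrow> real"
  assumes "transition_kernel Q"
    and "markov_family P X Q"
    and "f \<in> borel_measurable borel" and "\<And>x. 0 \<le> f x" and "bounded (range f)"
    and "\<And>k. \<delta> k \<in> {0..1}" and "\<And>i j. i < j \<Longrightarrow> \<delta> j < \<delta> i"
    and "\<delta> 0 = 1" and "\<delta> \<longlonglongrightarrow> 0"
    and "\<And>i j. \<delta> i * \<delta> j \<le> \<delta> (i + j)"
    and "lower_semicontinuous f"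
    and "\<And>(g :: 'x \<Rightarrow> real) (xs :: nat \<Rightarrow> 'x) x.
           g \<in> borel_measurable borel \<Longrightarrow> bounded (range g) \<Longrightarrow> xs \<longlonglongrightarrow> x \<Longrightarrow>
           liminf (\<lambda>n. ereal (\<integral>y. g y \<partial>Q (xs n))) \<ge> ereal (\<integral>y. g y \<partial>Q x)"
  shows "optimal_equilibrium P X \<delta> f (\<Inter>(equilibria P X \<delta> f)) \<and>
         (\<forall>S. optimal_equilibrium P X \<delta> f S \<longrightarrow> S = \<Inter>(equilibria P X \<delta> f))"
proof -
  note f_nonneg = assms(4) and \<delta>_mult = assms(10) and feller = assms(12)
  have Q: "Q \<in> borel \<rightarrow>\<^sub>M prob_algebra borel" using assms(1) by (simp add: transition_kernel_def)
  have \<delta>_nonneg: "0 \<le> \<delta> k" for k using assms(6)[of k] by simp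
  obtain B where B: "\<And>y. f y \<le> B"
    using assms(5) unfolding bounded_iff by (auto intro: abs_le_D1)
  interpret discounted_stopping Q "\<lambda>k. ennreal (\<delta> k)" "\<lambda>y. ennreal (f y)" "ennreal B"
  proof unfold_locales
    show "ennreal (\<delta> (Suc k)) \<le> ennreal (\<delta> 1)" for k
      using assms(7)[of 1 "Suc k"] by (cases "k = 0") (auto intro: ennreal_leI)
    show "ennreal (\<delta> 1) < 1" using assms(7)[of 0 1] assms(8) by simp
    show "ennreal (\<delta> i) * ennreal (\<delta> j) \<le> ennreal (\<delta> (i + j))" for i j
      using \<delta>_mult \<delta>_nonneg by (simp add: ennreal_leI flip: ennreal_mult)
  qed (use Q assms(3) B in \<open>auto intro: ennreal_leI\<close>)
  have J: "ennreal (J P X \<delta> f x (\<rho> X x S)) = payoff S x" if "S \<in> sets borel" for S x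
    using ennreal_J_eq[where f = f and \<delta> = \<delta> and x = x, OF Q assms(2,3) f_nonneg \<delta>_nonneg that]
      payoff_le[OF that, of x] by (simp add: payoff_def W_def le_less_trans[OF _ ennreal_less_top])
  have \<Theta>: "\<Theta> P X \<delta> f S = {x. payoff S x \<le> ennreal (f x)}" if "S \<in> sets borel" for S
    using f_nonneg by (auto simp: \<Theta>_def ennreal_le_iff simp flip: J[OF that])
  have "open {x. q < (\<integral>\<^sup>+y. g y \<partial>Q x)}"
    if "g \<in> borel_measurable borel" "\<And>y. g y \<le> ennreal B" for g q
    using open_nn_integral_greater[where Q = Q and g = g and B = B and q = q] Q feller that
    by blast
  note least = Inter_pre_equilibria[OF this]
  let ?R = "\<Inter>pre_equilibria"
  have R_eq: "?R \<in> equilibria P X \<delta> f"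
    using least(1,2) by (simp add: equilibria_def \<Theta>)
  have eq_sub: "equilibria P X \<delta> f \<subseteq> pre_equilibria"
    using \<Theta> by (auto simp: equilibria_def pre_equilibria_def)
  then have R: "\<Inter>(equilibria P X \<delta> f) = ?R"
    using R_eq by blast
  have J_le: "J P X \<delta> f x (\<rho> X x S) \<le> J P X \<delta> f x (\<rho> X x ?R)"
    if "S \<in> equilibria P X \<delta> f" for S x
  proof -
    \<comment> \<open>Needed to bring the inequality back from \<open>ennreal\<close>, which sends
      negative reals to 0.\<close>
    have "0 \<le> J P X \<delta> f x (\<rho> X x ?R)"
      unfolding J_def using f_nonneg \<delta>_nonneg
      by (intro Bochner_Integration.integral_nonneg) (auto simp: discounted_payoff_def split: enat.split)
    moreover have "payoff S x \<le> payoff ?R x"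
      using that eq_sub by (intro least(3)) auto
    ultimately show ?thesis
      using that R_eq J[of S x] J[of ?R x] by (simp add: equilibria_def flip: ennreal_le_iff)
  qed
  have optimal: "optimal_equilibrium P X \<delta> f ?R"
    unfolding optimal_equilibrium_def V_def using R_eq J_le
    by (intro conjI ballI allI max.mono order_refl)
  have "S = ?R" if "optimal_equilibrium P X \<delta> f S" for S
  proof -
    have S: "S \<in> equilibria P X \<delta> f" "\<And>x. V P X \<delta> f x ?R \<le> V P X \<delta> f x S"
      using that R_eq by (auto simp: optimal_equilibrium_def)
    \<comment> \<open>An equilibrium is recovered from its value function as the set where stopping
      attains it, so optimal equilibria, having equal values, coincide.\<close>
    have V_iff: "x \<in> T \<longleftrightarrow> V P X \<delta> f x T \<le> f x" if "T \<in> equilibria P X \<delta> f" for T x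
      using that by (auto simp: equilibria_def \<Theta>_def V_def)
    have "V P X \<delta> f x S = V P X \<delta> f x ?R" for x
      using S optimal by (auto simp: optimal_equilibrium_def intro: antisym)
    then show ?thesis
      using V_iff[OF S(1)] V_iff[OF R_eq] by auto
  qed
  with optimal show ?thesis unfolding R by blast
qed

end
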